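(* For every total Boolean function $g:\{0,1\}^m \to \{0,1\}$, $$\mathsf{RS}(g)=\widetilde{\Omega}(\mathsf{D}^{\mathsf{prod}}(g)).$$
   Context: A deterministic decision tree on $m$ variables is a binary tree whose internal nodes are labelled by variables $x_i$ ($i\in[m]$) with two children for $x_i=0$ and $x_i=1$; it is run on an input $x\in\{0,1\}^m$ by following the path from the root determined by the queried values. Its depth is its cost. A randomized decision tree is a probability distribution over deterministic decision trees; its query complexity is the maximum depth of a tree in its support. For a distribution $\mu$ on $\{0,1\}^m$ and $\epsilon\in[0,1/2]$, $\mathsf{D}^\mu_\epsilon(g)$ is the minimum depth of a deterministic decision tree $T$ (with leaves labelled by bits) such that $\Pr_{x\sim\mu}[T(x)\neq g(x)]\le\epsilon$. A distribution $\mu$ on $\{0,1\}^m$ is a product distribution if there are $p_1,\dots,p_m\in[0,1]$ such that each $x_i$ is independently $1$ with probability $p_i$; $\mathsf{PROD}$ denotes the set of product distributions. $\mathsf{D}^{\mathsf{prod}}_\epsilon(g):=\max_{\mu\in\mathsf{PROD}}\mathsf{D}^\mu_\epsilon(g)$ and $\mathsf{D}^{\mathsf{prod}}(g):=\mathsf{D}^{\mathsf{prod}}_{1/3}(g)$. The sabotage complexity $\mathsf{RS}_\epsilon(g)$ is the minimum query complexity of a randomized decision tree $\mathcal{R}$ such that for every $x\in g^{-1}(0)$ and $y\in g^{-1}(1)$, with probability at least $1-\epsilon$ a tree $T$ drawn from $\mathcal{R}$, when run on $x$, queries some index $i$ with $x_i\neq y_i$; $\mathsf{RS}(g):=\mathsf{RS}_{1/3}(g)$.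 The notation $\widetilde{\Omega}$ hides polylogarithmic factors. *)

theory Defs
  imports "HOL-Probability.Probability" "HOL-Probability.Product_PMF"
begin

text \<open>
  The hypercube \<open>{0,1}\<^sup>m\<close> is the set of all \<open>x :: nat \<Rightarrow> bool\<close> that are \<open>False\<close> outside
  \<open>{..<m}\<close>, so that it carries \<^const>\<open>Pi_pmf\<close>. A Boolean function on \<open>{0,1}\<^sup>m\<close> is given by
  some \<open>g :: (nat \<Rightarrow> bool) \<Rightarrow> bool\<close>; its values outside the cube are never used.
\<close>

definition cube :: "nat \<Rightarrow> (nat \<Rightarrow> bool) set" where
  "cube m = PiE_dflt {..<m} False (\<lambda>_. UNIV)"

datatype 'l dtree = Leaf 'l | Query nat "'l dtree" "'l dtree"

fun dt_vars :: "'l dtree \<Rightarrow> nat set" where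
  "dt_vars (Leaf l) = {}"
| "dt_vars (Query i t0 t1) = insert i (dt_vars t0 \<union> dt_vars t1)"

fun dt_depth :: "'l dtree \<Rightarrow> nat" where
  "dt_depth (Leaf l) = 0"
| "dt_depth (Query i t0 t1) = Suc (max (dt_depth t0) (dt_depth t1))"

fun dt_run :: "'l dtree \<Rightarrow> (nat \<Rightarrow> bool) \<Rightarrow> 'l" where
  "dt_run (Leaf l) x = l"
| "dt_run (Query i t0 t1) x = (if x i then dt_run t1 x else dt_run t0 x)"

fun dt_queried :: "'l dtree \<Rightarrow> (nat \<Rightarrow> bool) \<Rightarrow> nat set" where
  "dt_queried (Leaf l) x = {}"
| "dt_queried (Query i t0 t1) x = insert i (if x i then dt_queried t1 x else dt_queried t0 x)"

definition dtrees :: "nat \<Rightarrow> 'l dtree set" where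
  "dtrees m = {T. dt_vars T \<subseteq> {..<m}}"

definition D_dist :: "real \<Rightarrow> nat \<Rightarrow> (nat \<Rightarrow> bool) pmf \<Rightarrow> ((nat \<Rightarrow> bool) \<Rightarrow> bool) \<Rightarrow> nat" where
  "D_dist \<epsilon> m \<mu> g =
     (LEAST d. \<exists>T \<in> dtrees m. dt_depth T = d \<and> measure_pmf.prob \<mu> {x. dt_run T x \<noteq> g x} \<le> \<epsilon>)"

definition prod_dists :: "nat \<Rightarrow> (nat \<Rightarrow> bool) pmf set" where
  "prod_dists m = {Pi_pmf {..<m} False (\<lambda>i. bernoulli_pmf (p i)) | p. \<forall>i<m. p i \<in> {0..1}}"

definition D_prod_eps :: "real \<Rightarrow> nat \<Rightarrow> ((nat \<Rightarrow> bool) \<Rightarrow> bool) \<Rightarrow> nat" where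
  "D_prod_eps \<epsilon> m g = Max {D_dist \<epsilon> m \<mu> g | \<mu>. \<mu> \<in> prod_dists m}"

definition D_prod :: "nat \<Rightarrow> ((nat \<Rightarrow> bool) \<Rightarrow> bool) \<Rightarrow> nat" where
  "D_prod = D_prod_eps (1/3)"

text \<open>
  Leaf labels are irrelevant for sabotage, hence trees of type \<^typ>\<open>unit dtree\<close>. Bounded depth
  in the support is what makes the maximum in \<open>query_complexity\<close> exist.
\<close>

definition rand_dtrees :: "nat \<Rightarrow> unit dtree pmf set" where
  "rand_dtrees m = {R. set_pmf R \<subseteq> dtrees m \<and> finite (dt_depth ` set_pmf R)}"

definition query_complexity :: "unit dtree pmf \<Rightarrow> nat" where
  "query_complexity R = Max (dt_depth ` set_pmf R)"

definition sabotages :: "real \<Rightarrow> nat \<Rightarrow> ((nat \<Rightarrow> bool) \<Rightarrow> bool) \<Rightarrow> unit dtree pmf \<Rightarrow> bool" where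
  "sabotages \<epsilon> m g R \<longleftrightarrow>
     (\<forall>x \<in> cube m. \<forall>y \<in> cube m. \<not> g x \<longrightarrow> g y \<longrightarrow>
        measure_pmf.prob R {T. \<exists>i \<in> dt_queried T x. x i \<noteq> y i} \<ge> 1 - \<epsilon>)"

definition RS_eps :: "real \<Rightarrow> nat \<Rightarrow> ((nat \<Rightarrow> bool) \<Rightarrow> bool) \<Rightarrow> nat" where
  "RS_eps \<epsilon> m g = (LEAST q. \<exists>R \<in> rand_dtrees m. query_complexity R = q \<and> sabotages \<epsilon> m g R)"

definition RS :: "nat \<Rightarrow> ((nat \<Rightarrow> bool) \<Rightarrow> bool) \<Rightarrow> nat" where
  "RS = RS_eps (1/3)"

text \<open>
  The minima and the maximum above are taken over nonempty (resp. nonempty finite) sets: the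
  tree querying all variables computes any function exactly and separates any two inputs.
\<close>

fun full_tree :: "nat \<Rightarrow> ((nat \<Rightarrow> bool) \<Rightarrow> 'l) \<Rightarrow> 'l dtree" where
  "full_tree 0 f = Leaf (f (\<lambda>_. False))"
| "full_tree (Suc n) f =
     Query n (full_tree n (\<lambda>x. f (x(n := False)))) (full_tree n (\<lambda>x. f (x(n := True))))"

lemma full_tree_depth: "dt_depth (full_tree n f) = n"
  by (induction n arbitrary: f) auto

lemma full_tree_vars: "dt_vars (full_tree n f) = {..<n}"
  by (induction n arbitrary: f) auto

lemma full_tree_queried: "dt_queried (full_tree n f) x = {..<n}"
  by (induction n arbitrary: f) auto

lemma full_tree_run: "dt_run (full_tree n f) x = f (\<lambda>i. i < n \<and> x i)"
proof (induction n arbitrary: f)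
  case (Suc n)
  have "(\<lambda>i. i < n \<and> x i)(n := x n) = (\<lambda>i. i < Suc n \<and> x i)"
    by (auto simp: less_Suc_eq fun_eq_iff)
  then show ?case
    by (cases "x n") (auto simp: Suc.IH)
qed auto

lemma cube_restrict: "x \<in> cube m \<Longrightarrow> (\<lambda>i. i < m \<and> x i) = x"
  by (auto simp: cube_def PiE_dflt_def)

lemma set_pmf_prod_dists: "\<mu> \<in> prod_dists m \<Longrightarrow> set_pmf \<mu> \<subseteq> cube m"
  using set_Pi_pmf_subset'[of "{..<m}" False]
  by (fastforce simp: prod_dists_def cube_def PiE_dflt_def)

lemma D_dist_attained:
  assumes "\<mu> \<in> prod_dists m" "\<epsilon> \<ge> 0"
  shows "\<exists>T \<in> dtrees m. dt_depth T = D_dist \<epsilon> m \<mu> g \<and>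
           measure_pmf.prob \<mu> {x. dt_run T x \<noteq> g x} \<le> \<epsilon>"
    and "D_dist \<epsilon> m \<mu> g \<le> m"
proof -
  let ?P = "\<lambda>d. \<exists>T \<in> dtrees m. dt_depth T = d \<and> measure_pmf.prob \<mu> {x. dt_run T x \<noteq> g x} \<le> \<epsilon>"
  have "measure_pmf.prob \<mu> {x. dt_run (full_tree m g) x \<noteq> g x} = 0"
    using set_pmf_prod_dists[OF assms(1)]
    by (auto simp: measure_pmf_zero_iff full_tree_run cube_restrict subset_iff)
  then have P: "?P m"
    using assms(2) by (intro bexI[of _ "full_tree m g"])
      (auto simp: full_tree_depth full_tree_vars dtrees_def)
  show "?P (D_dist \<epsilon> m \<mu> g)" unfolding D_dist_def by (rule LeastI[of ?P, OF P])
  show "D_dist \<epsilon> m \<mu> g \<le> m" unfolding D_dist_def by (rule Least_le[of ?P, OF P])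
qed

lemma D_prod_eps_set:
  assumes "\<epsilon> \<ge> 0"
  shows "finite {D_dist \<epsilon> m \<mu> g | \<mu>. \<mu> \<in> prod_dists m}" "{D_dist \<epsilon> m \<mu> g | \<mu>. \<mu> \<in> prod_dists m} \<noteq> {}"
proof -
  show "finite {D_dist \<epsilon> m \<mu> g | \<mu>. \<mu> \<in> prod_dists m}"
    by (rule finite_subset[of _ "{..m}"]) (auto intro: D_dist_attained(2) assms)
  have "Pi_pmf {..<m} False (\<lambda>i. bernoulli_pmf 0) \<in> prod_dists m"
    unfolding prod_dists_def by (rule CollectI, rule exI[of _ "\<lambda>_. 0"]) auto
  then show "{D_dist \<epsilon> m \<mu> g | \<mu>. \<mu> \<in> prod_dists m} \<noteq> {}" by blast
qed

lemma RS_eps_attained: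
  assumes "\<epsilon> \<ge> 0"
  shows "\<exists>R \<in> rand_dtrees m. query_complexity R = RS_eps \<epsilon> m g \<and> sabotages \<epsilon> m g R"
    and "RS_eps \<epsilon> m g \<le> m"
proof -
  let ?P = "\<lambda>q. \<exists>R \<in> rand_dtrees m. query_complexity R = q \<and> sabotages \<epsilon> m g R"
  define R where "R = return_pmf (full_tree m (\<lambda>_. ()))"
  have "\<exists>i<m. x i \<noteq> y i" if "x \<in> cube m" "y \<in> cube m" "\<not> g x" "g y" for x y
  proof (rule ccontr)
    assume "\<not> ?thesis"
    then have "(\<lambda>i. i < m \<and> x i) = (\<lambda>i. i < m \<and> y i)" by auto
    then show False using that by (simp add: cube_restrict)
  qed
  then have "sabotages \<epsilon> m g R"
    using assms by (fastforce simp: sabotages_def R_def full_tree_queried indicator_def)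
  then have P: "?P m"
    by (intro bexI[of _ R])
      (auto simp: R_def rand_dtrees_def query_complexity_def dtrees_def
        full_tree_depth full_tree_vars)
  show "?P (RS_eps \<epsilon> m g)" unfolding RS_eps_def by (rule LeastI[of ?P, OF P])
  show "RS_eps \<epsilon> m g \<le> m" unfolding RS_eps_def by (rule Least_le[of ?P, OF P])
qed

end

theory Submission
  imports Defs "HOL-Combinatorics.Transposition"
begin

text \<open>
  Let \<open>\<mu>\<close> be a product distribution, \<open>q = RS g\<close> and \<open>k = 3 q + 1\<close>. For a tree \<open>T\<close>, draw \<open>x\<close> from \<open>\<mu>\<close>
  and resample each coordinate not queried by \<open>T\<close> on \<open>x\<close> with probability \<open>1/k\<close>; let \<open>\<Phi>(T)\<close> be the
  probability that this changes the value of \<open>g\<close>. If \<open>T\<close> is followed by a tree \<open>U\<close> drawn from an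
  optimal sabotage algorithm, then with probability at least \<open>(1 - 1/k)\<^sup>q \<ge> 2/3\<close> no query of \<open>U\<close>
  is resampled, in which case \<open>U\<close> does not separate the two inputs. It fails to separate inputs
  with different values with probability at most \<open>1/3\<close>, so some \<open>U\<close> gives \<open>\<Phi>(T; U) \<le> \<Phi>(T) / 2\<close>.
  Hence \<open>t\<close> rounds produce a tree \<open>T\<close> of depth at most \<open>q t\<close> with \<open>\<Phi>(T) \<le> 2\<^sup>-\<^sup>t\<close>.

  Resampling all unqueried coordinates amounts to resampling \<open>k\<close> random blocks one after the other,
  and each of these steps is distributed like the noise in \<open>\<Phi>\<close>. So it changes \<open>g\<close> with probability
  at most \<open>k \<Phi>(T)\<close>, which is at most \<open>1/3\<close> for some \<open>t = O(log q)\<close>. Labelling the leaves of \<open>T\<close> by the values of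
  \<open>g\<close> after completing the queried bits with a fixed good sample \<open>z\<close> then computes \<open>g\<close> up to
  error \<open>1/3\<close>, whence \<open>D\<^sup>p\<^sup>r\<^sup>o\<^sup>d = O(q log q)\<close>.
\<close>

section \<open>Events of product distributions\<close>

lemma prob_pair_pmf:
  "measure_pmf.prob (pair_pmf A B) X =
     measure_pmf.expectation A (\<lambda>a. measure_pmf.prob B {b. (a, b) \<in> X})"
proof -
  have "emeasure (pair_pmf A B) X = (\<integral>\<^sup>+a. \<integral>\<^sup>+b. indicator X (a, b) \<partial>B \<partial>A)"
    by (subst nn_integral_pair_pmf'[symmetric]) simp
  also have "\<dots> = (\<integral>\<^sup>+a. \<integral>\<^sup>+b. indicator {b. (a, b) \<in> X} b \<partial>B \<partial>A)"
    by (intro nn_integral_cong) (simp add: indicator_def)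
  also have "\<dots> = (\<integral>\<^sup>+a. ennreal (measure_pmf.prob B {b. (a, b) \<in> X}) \<partial>A)"
    by (simp add: measure_pmf.emeasure_eq_measure)
  also have "\<dots> = ennreal (measure_pmf.expectation A (\<lambda>a. measure_pmf.prob B {b. (a, b) \<in> X}))"
    by (intro nn_integral_eq_integral measure_pmf.integrable_const_bound[where B = 1]) auto
  finally show ?thesis
    by (simp add: measure_pmf.emeasure_eq_measure)
qed

text \<open>Conditioning on the first component reduces the comparison to fixed \<open>a\<close>.
  The constants let it serve for the sabotage error 1/3 with the noise fixed and for the survival
  probability 2/3 with the inputs fixed.\<close>

lemma prob_pair_pmf_mono:
  assumes "\<And>a. a \<in> set_pmf A \<Longrightarrow>
    c * measure_pmf.prob B {b. (a, b) \<in> X} \<le> d * measure_pmf.prob B {b. (a, b) \<in> Y}"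
  shows "c * measure_pmf.prob (pair_pmf A B) X \<le> d * measure_pmf.prob (pair_pmf A B) Y"
proof -
  have int: "integrable A (\<lambda>a. measure_pmf.prob B {b. (a, b) \<in> Z})" for Z
    by (intro measure_pmf.integrable_const_bound[where B = 1]) auto
  have "measure_pmf.expectation A (\<lambda>a. c * measure_pmf.prob B {b. (a, b) \<in> X})
      \<le> measure_pmf.expectation A (\<lambda>a. d * measure_pmf.prob B {b. (a, b) \<in> Y})"
    by (intro integral_mono_AE integrable_mult_right int) (auto simp: AE_measure_pmf_iff assms)
  then show ?thesis
    by (simp add: prob_pair_pmf)
qed

lemma prob_pair_pmf_swap:
  "measure_pmf.prob (pair_pmf A B) X = measure_pmf.prob (pair_pmf B A) {(b, a). (a, b) \<in> X}"
  by (subst pair_commute_pmf) (auto simp: vimage_def intro!: arg_cong2[where f = measure])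

text \<open>Some outcome is at most the average. This is how one tree \<open>U\<close> and one
  completion \<open>z\<close> get fixed.\<close>

lemma ex_prob_le_prob_pair_pmf:
  "\<exists>a \<in> set_pmf A. measure_pmf.prob B {b. (a, b) \<in> X} \<le> measure_pmf.prob (pair_pmf A B) X"
proof (rule ccontr)
  assume "\<not> ?thesis"
  then have "measure_pmf.prob (pair_pmf A B) X
      < measure_pmf.expectation A (\<lambda>a. measure_pmf.prob B {b. (a, b) \<in> X})"
    by (intro measure_pmf.expectation_greater measure_pmf.integrable_const_bound[where B = 1])
      (auto simp: AE_measure_pmf_iff not_le)
  then show False
    by (simp add: prob_pair_pmf)
qed

lemma prob_pair_pmf_Times:
  "measure_pmf.prob (pair_pmf A B) {(a, b). P a \<and> Q b} =
     measure_pmf.prob A {a. P a} * measure_pmf.prob B {b. Q b}"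
proof -
  have "measure_pmf.prob B {b. P a \<and> Q b} = indicator {a. P a} a * measure_pmf.prob B {b. Q b}" for a
    by (auto simp: indicator_def)
  then show ?thesis
    by (simp add: prob_pair_pmf)
qed

lemma map_pmf_involution:
  assumes "\<And>w. f (f w) = w" "\<And>w. pmf P (f w) = pmf P w"
  shows "map_pmf f P = P"
proof (rule pmf_eqI)
  fix w
  have "inj f"
    by (metis assms(1) injI)
  then have "pmf (map_pmf f P) (f (f w)) = pmf P (f w)"
    by (rule pmf_map_inj')
  then show "pmf (map_pmf f P) w = pmf P w"
    by (simp add: assms)
qed

text \<open>Splitting the product into coordinates in \<open>A\<close> and outside \<open>A\<close>
  makes the two events independent, as \<open>F\<close> ignores the former.\<close>

lemma prob_Pi_pmf_indep:
  assumes "finite U" "A \<subseteq> U"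
    and F: "\<And>f h. (\<And>i. i \<notin> A \<Longrightarrow> f i = h i) \<Longrightarrow> F f = F h"
  shows "measure_pmf.prob (Pi_pmf U d p) {f. (\<forall>i\<in>A. G i (f i)) \<and> F f} =
     (\<Prod>i\<in>A. measure_pmf.prob (p i) {v. G i v}) * measure_pmf.prob (Pi_pmf U d p) {f. F f}"
proof -
  have A: "finite A"
    using assms finite_subset by blast
  let ?P1 = "Pi_pmf A d p" and ?P2 = "Pi_pmf (U - A) d p"
  have U: "Pi_pmf U d p = map_pmf (\<lambda>(f, h) i. if i \<in> A then f i else h i) (pair_pmf ?P1 ?P2)"
    using Pi_pmf_union[of A "U - A" d p] A assms by (simp add: Un_absorb1)
  have F': "F (\<lambda>i. if i \<in> A then f i else h i) = F h" for f h
    by (rule F) simp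
  have "measure_pmf.prob (Pi_pmf U d p) {f. (\<forall>i\<in>A. G i (f i)) \<and> F f} =
      measure_pmf.prob (pair_pmf ?P1 ?P2) {(f, h). (\<forall>i\<in>A. G i (f i)) \<and> F h}"
    by (auto simp: U vimage_def F' intro!: arg_cong2[where f = measure])
  also have "\<dots> = measure_pmf.prob ?P1 (Pi A (\<lambda>i. {v. G i v})) * measure_pmf.prob ?P2 {h. F h}"
    by (simp only: prob_pair_pmf_Times) (simp add: Pi_def Ball_def)
  also have "measure_pmf.prob ?P2 {h. F h} =
      measure_pmf.prob (pair_pmf ?P1 ?P2) {(f, h). True \<and> F h}"
    by (subst prob_pair_pmf_Times) simp
  also have "\<dots> = measure_pmf.prob (Pi_pmf U d p) {f. F f}"
    by (auto simp: U vimage_def F' intro!: arg_cong2[where f = measure])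
  finally show ?thesis
    by (simp add: measure_Pi_pmf_Pi A)
qed

section \<open>Decision trees\<close>

fun dt_seq :: "'l dtree \<Rightarrow> 'l dtree \<Rightarrow> 'l dtree" where
  "dt_seq (Leaf l) U = U"
| "dt_seq (Query i t0 t1) U = Query i (dt_seq t0 U) (dt_seq t1 U)"

text \<open>\<open>z\<close> records the answers along the path; its initial value supplies the
  unqueried bits.\<close>

fun dt_relabel :: "((nat \<Rightarrow> bool) \<Rightarrow> 'b) \<Rightarrow> 'a dtree \<Rightarrow> (nat \<Rightarrow> bool) \<Rightarrow> 'b dtree" where
  "dt_relabel g (Leaf l) z = Leaf (g z)"
| "dt_relabel g (Query i t0 t1) z =
     Query i (dt_relabel g t0 (z(i := False))) (dt_relabel g t1 (z(i := True)))"

lemma dt_seq_queried: "dt_queried (dt_seq T U) x = dt_queried T x \<union> dt_queried U x"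
  by (induction T) auto

lemma dt_seq_depth: "dt_depth (dt_seq T U) \<le> dt_depth T + dt_depth U"
  by (induction T) auto

lemma dt_seq_dtrees: "T \<in> dtrees m \<Longrightarrow> U \<in> dtrees m \<Longrightarrow> dt_seq T U \<in> dtrees m"
  unfolding dtrees_def by (induction T) auto

lemma dt_relabel_vars: "dt_vars (dt_relabel g T z) = dt_vars T"
  by (induction T arbitrary: z) auto

lemma dt_relabel_depth: "dt_depth (dt_relabel g T z) = dt_depth T"
  by (induction T arbitrary: z) auto

lemma dt_relabel_run:
  "dt_run (dt_relabel g T z) x = g (override_on z x (dt_queried T x))"
proof (induction T arbitrary: z)
  case (Query i t0 t1)
  then show ?case
    by (auto simp: override_on_def fun_eq_iff intro!: arg_cong[where f = g])
qed simp

lemma dt_queried_cong: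
  "(\<And>i. i \<in> dt_queried T x \<Longrightarrow> x i = y i) \<Longrightarrow> dt_queried T y = dt_queried T x"
  by (induction T) (auto split: if_splits)

lemma dt_queried_override [simp]:
  "dt_queried T (override_on x y (W - dt_queried T x)) = dt_queried T x"
  by (rule dt_queried_cong) (simp add: override_on_def)

lemma finite_dt_queried: "finite (dt_queried T x)"
  by (induction T) auto

lemma card_dt_queried: "card (dt_queried T x) \<le> dt_depth T"
proof (induction T)
  case (Query i t0 t1)
  then show ?case
    by (auto intro!: order_trans[OF card_insert_le_m1] simp: card_insert_if finite_dt_queried)
qed simp

lemma dt_queried_subset: "T \<in> dtrees m \<Longrightarrow> dt_queried T x \<subseteq> {..<m}"
  unfolding dtrees_def by (induction T) (auto split: if_splits)

lemma dt_depth_le_query_complexity: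
  "R \<in> rand_dtrees m \<Longrightarrow> T \<in> set_pmf R \<Longrightarrow> dt_depth T \<le> query_complexity R"
  unfolding rand_dtrees_def query_complexity_def by (auto intro: Max_ge)

lemma override_on_cube: "x \<in> cube m \<Longrightarrow> y \<in> cube m \<Longrightarrow> override_on x y S \<in> cube m"
  by (auto simp: cube_def PiE_dflt_def override_on_def)

text \<open>\<open>sabotages\<close> runs trees on the input with value \<open>False\<close>. The
  roles can be swapped because a tree that sees no difference queries the same variables on both
  inputs.\<close>

lemma sabotages_agree_prob:
  assumes "sabotages \<epsilon> m g R" "x \<in> cube m" "y \<in> cube m" "g x \<noteq> g y"
  shows "measure_pmf.prob R {T. \<forall>i \<in> dt_queried T x. x i = y i} \<le> \<epsilon>"
proof -
  have le: "measure_pmf.prob R {T. \<forall>i \<in> dt_queried T u. u i = v i} \<le> \<epsilon>"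
    if "u \<in> cube m" "v \<in> cube m" "\<not> g u" "g v" for u v
  proof -
    let ?S = "{T. \<exists>i \<in> dt_queried T u. u i \<noteq> v i}"
    have "{T. \<forall>i \<in> dt_queried T u. u i = v i} = space R - ?S"
      by auto
    moreover have "measure_pmf.prob R ?S \<ge> 1 - \<epsilon>"
      using assms(1) that unfolding sabotages_def by blast
    ultimately show ?thesis
      using measure_pmf.prob_compl[of ?S R] by simp
  qed
  have "(\<forall>i \<in> dt_queried T x. x i = y i) = (\<forall>i \<in> dt_queried T y. y i = x i)" for T :: "unit dtree"
    using dt_queried_cong[of T x y] dt_queried_cong[of T y x] by metis
  then show ?thesis
    using le[of x y] le[of y x] assms(2-4) by (cases "g x") simp_all
qed

section \<open>Resampling noise\<close>

text \<open>
  Coordinates outside the cube get the block number \<open>k\<close>, which belongs to no block, so that they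
  are never resampled and permutations of the blocks leave them alone.
\<close>

definition block_pmf :: "nat \<Rightarrow> nat \<Rightarrow> (nat \<Rightarrow> nat) pmf" where
  "block_pmf m k = Pi_pmf {..<m} k (\<lambda>_. pmf_of_set {..<k})"

definition noise_pmf ::
    "nat \<Rightarrow> nat \<Rightarrow> (nat \<Rightarrow> bool) pmf \<Rightarrow> (((nat \<Rightarrow> bool) \<times> (nat \<Rightarrow> bool)) \<times> (nat \<Rightarrow> nat)) pmf" where
  "noise_pmf m k \<mu> = pair_pmf (pair_pmf \<mu> \<mu>) (block_pmf m k)"

text \<open>Block 0 contains each coordinate of the cube independently with probability
  \<open>1/k\<close>, so it models the noise; this is the overview's potential of
  \<open>T\<close>.\<close>

definition noise_sens ::
    "nat \<Rightarrow> nat \<Rightarrow> (nat \<Rightarrow> bool) pmf \<Rightarrow> ((nat \<Rightarrow> bool) \<Rightarrow> bool) \<Rightarrow> 'l dtree \<Rightarrow> real" where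
  "noise_sens m k \<mu> g T = measure_pmf.prob (noise_pmf m k \<mu>)
     {((x, y), b). g x \<noteq> g (override_on x y ({i. b i = 0} - dt_queried T x))}"

lemma block_pmf_avoid:
  assumes "A \<subseteq> {..<m}" "k > 0"
    and "\<And>b c. (\<And>i. i \<notin> A \<Longrightarrow> b i = c i) \<Longrightarrow> F b = F c"
  shows "measure_pmf.prob (block_pmf m k) {b. (\<forall>i\<in>A. b i \<noteq> 0) \<and> F b} =
     (1 - 1 / real k) ^ card A * measure_pmf.prob (block_pmf m k) {b. F b}"
proof -
  have "{..<k} \<inter> {v. v \<noteq> 0} = {..<k} - {0}"
    by auto
  then have "measure_pmf.prob (pmf_of_set {..<k}) {v. v \<noteq> 0} = 1 - 1 / real k"
    using assms(2) by (subst measure_pmf_of_set) (auto simp: field_simps of_nat_diff)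
  moreover have "measure_pmf.prob (block_pmf m k) {b. (\<forall>i\<in>A. b i \<noteq> 0) \<and> F b} =
      (\<Prod>i\<in>A. measure_pmf.prob (pmf_of_set {..<k}) {v. v \<noteq> 0}) *
      measure_pmf.prob (block_pmf m k) {b. F b}"
    unfolding block_pmf_def by (rule prob_Pi_pmf_indep) (use assms in blast)+
  ultimately show ?thesis
    by (simp only: prod_constant)
qed

lemma noise_sens_halving:
  assumes R: "R \<in> rand_dtrees m" "sabotages (1/3) m g R"
    and \<mu>: "set_pmf \<mu> \<subseteq> cube m" and T: "T \<in> dtrees m"
    and k: "k \<ge> 3 * query_complexity R" "k > 0"
  shows "\<exists>U \<in> set_pmf R. noise_sens m k \<mu> g (dt_seq T U) \<le> noise_sens m k \<mu> g T / 2"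
proof -
  define q where "q = query_complexity R"
  define P where "P = noise_pmf m k \<mu>"
  define z where "z = (\<lambda>x y (b :: nat \<Rightarrow> nat). override_on x y ({i. b i = 0} - dt_queried T x))"
  \<comment> \<open>The noise after \<open>T\<close> changes \<open>g\<close>, yet \<open>U\<close>
    does not notice it. Bounding this event from above and below yields the halving.\<close>
  define E where "E = {(w, U :: unit dtree). case w of ((x, y), b) \<Rightarrow>
    g x \<noteq> g (z x y b) \<and> (\<forall>i \<in> dt_queried U x. x i = z x y b i)}"
  define N where "N = {(w, U :: unit dtree). case w of ((x, y), b) \<Rightarrow> g x \<noteq> g (z x y b)}"
  have "1 * measure_pmf.prob (pair_pmf P R) E \<le> (1/3) * measure_pmf.prob (pair_pmf P R) N"
  proof (rule prob_pair_pmf_mono)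
    fix w assume "w \<in> set_pmf P"
    moreover obtain x y b where w: "w = ((x, y), b)"
      by (metis prod.exhaust)
    ultimately have xy: "x \<in> cube m" "y \<in> cube m"
      using \<mu> by (auto simp: P_def noise_pmf_def)
    then have "z x y b \<in> cube m"
      by (simp add: z_def override_on_cube)
    then show "1 * measure_pmf.prob R {U. (w, U) \<in> E} \<le> (1/3) * measure_pmf.prob R {U. (w, U) \<in> N}"
      using sabotages_agree_prob[OF R(2), of x "z x y b"] xy
      by (cases "g x = g (z x y b)") (auto simp: E_def N_def w)
  qed
  also have "measure_pmf.prob (pair_pmf P R) N = noise_sens m k \<mu> g T"
    using prob_pair_pmf_Times[of P R "\<lambda>((x, y), b). g x \<noteq> g (z x y b)" "\<lambda>_. True"]
    by (simp add: N_def noise_sens_def P_def z_def case_prod_unfold)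
  finally have E: "measure_pmf.prob (pair_pmf P R) E \<le> noise_sens m k \<mu> g T / 3"
    by simp
  obtain U where U: "U \<in> set_pmf R"
    "measure_pmf.prob P {w. (w, U) \<in> E} \<le> measure_pmf.prob (pair_pmf P R) E"
    using ex_prob_le_prob_pair_pmf[of R P "{(U, w). (w, U) \<in> E}"]
    by (auto simp: prob_pair_pmf_swap[of P R])
  have Um: "U \<in> dtrees m" "dt_depth U \<le> q"
    using R(1) U(1) dt_depth_le_query_complexity unfolding rand_dtrees_def q_def by auto
  \<comment> \<open>\<open>U\<close> makes at most \<open>q\<close> queries, so with probability at least 2/3 none of them is resampled.\<close>
  have "2/3 * noise_sens m k \<mu> g (dt_seq T U) \<le> 1 * measure_pmf.prob P {w. (w, U) \<in> E}"
    unfolding noise_sens_def P_def noise_pmf_def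
  proof (rule prob_pair_pmf_mono)
    fix v :: "(nat \<Rightarrow> bool) \<times> (nat \<Rightarrow> bool)"
    obtain x y where v: "v = (x, y)"
      by (metis prod.exhaust)
    define A where "A = dt_queried U x"
    \<comment> \<open>\<open>F\<close> ignores the blocks of coordinates in \<open>A\<close>, since
      \<open>dt_seq T U\<close> queries them. When block 0 misses \<open>A\<close>, the noises for
      \<open>T\<close> and \<open>dt_seq T U\<close> coincide.\<close>
    define F where "F = (\<lambda>b :: nat \<Rightarrow> nat.
      g x \<noteq> g (override_on x y ({i. b i = 0} - dt_queried (dt_seq T U) x)))"
    let ?B = "measure_pmf.prob (block_pmf m k)"
    have "card A \<le> q"
      using card_dt_queried[of U x] Um(2) by (simp add: A_def)
    then have kA: "real k \<ge> 3 * real (card A)"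
      using k(1) by (simp add: q_def)
    have "2/3 \<le> 1 + real (card A) * (- 1 / real k)"
      using kA k(2) by (simp add: field_simps)
    also have "\<dots> \<le> (1 + - 1 / real k) ^ card A"
      using k(2) by (intro Bernoulli_inequality) (simp add: field_simps)
    finally have "2/3 \<le> (1 - 1 / real k) ^ card A"
      by simp
    then have "2/3 * ?B {b. F b} \<le> (1 - 1 / real k) ^ card A * ?B {b. F b}"
      by (intro mult_right_mono) auto
    also have "\<dots> = ?B {b. (\<forall>i\<in>A. b i \<noteq> 0) \<and> F b}"
    proof (rule block_pmf_avoid[symmetric])
      show "A \<subseteq> {..<m}"
        using dt_queried_subset[OF Um(1)] by (simp add: A_def)
      fix b c :: "nat \<Rightarrow> nat" assume "\<And>i. i \<notin> A \<Longrightarrow> b i = c i"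
      then have "{i. b i = 0} - dt_queried (dt_seq T U) x = {i. c i = 0} - dt_queried (dt_seq T U) x"
        by (auto simp: dt_seq_queried A_def)
      then show "F b = F c"
        by (simp add: F_def)
    qed (use k in auto)
    also have "\<dots> \<le> ?B {b. (v, b) \<in> {w. (w, U) \<in> E}}"
    proof (rule measure_pmf.finite_measure_mono)
      have "(((x, y), b), U) \<in> E"
        if b: "\<forall>i\<in>A. b i \<noteq> 0" "F b" for b
      proof -
        have "{i. b i = 0} - dt_queried (dt_seq T U) x = {i. b i = 0} - dt_queried T x"
          using b(1) by (auto simp: dt_seq_queried A_def)
        then have "g x \<noteq> g (z x y b)"
          using b(2) by (simp add: F_def z_def)
        moreover have "\<forall>i\<in>A. x i = z x y b i"
          using b(1) by (simp add: z_def)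
        ultimately show ?thesis
          by (simp add: E_def A_def)
      qed
      then show "{b. (\<forall>i\<in>A. b i \<noteq> 0) \<and> F b} \<subseteq> {b. (v, b) \<in> {w. (w, U) \<in> E}}"
        by (auto simp: v)
    qed simp
    finally show "2/3 * ?B {b. (v, b) \<in> {((x, y), b).
          g x \<noteq> g (override_on x y ({i. b i = 0} - dt_queried (dt_seq T U) x))}}
        \<le> 1 * ?B {b. (v, b) \<in> {w. (w, U) \<in> E}}"
      by (simp add: F_def v)
  qed
  then have "noise_sens m k \<mu> g (dt_seq T U) \<le> noise_sens m k \<mu> g T / 2"
    using U(2) E by simp
  with U(1) show ?thesis
    by blast
qed

lemma ex_noise_sens_le:
  assumes R: "R \<in> rand_dtrees m" "sabotages (1/3) m g R"
    and \<mu>: "set_pmf \<mu> \<subseteq> cube m"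
    and k: "k \<ge> 3 * query_complexity R" "k > 0"
  shows "\<exists>T :: unit dtree. T \<in> dtrees m \<and> dt_depth T \<le> query_complexity R * t \<and>
           noise_sens m k \<mu> g T \<le> 1 / 2 ^ t"
proof (induction t)
  case 0
  show ?case
    by (intro exI[of _ "Leaf ()"]) (auto simp: dtrees_def noise_sens_def)
next
  case (Suc t)
  then obtain T :: "unit dtree" where T: "T \<in> dtrees m" "dt_depth T \<le> query_complexity R * t"
    "noise_sens m k \<mu> g T \<le> 1 / 2 ^ t"
    by blast
  obtain U where U: "U \<in> set_pmf R"
    "noise_sens m k \<mu> g (dt_seq T U) \<le> noise_sens m k \<mu> g T / 2"
    using noise_sens_halving[OF R \<mu> T(1) k] by blast
  have "U \<in> dtrees m"
    using R(1) U(1) by (auto simp: rand_dtrees_def)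
  moreover have "dt_depth (dt_seq T U) \<le> query_complexity R * Suc t"
    using dt_seq_depth[of T U] T(2) dt_depth_le_query_complexity[OF R(1) U(1)] by simp
  ultimately show ?case
    using T U by (intro exI[of _ "dt_seq T U"]) (auto simp: dt_seq_dtrees)
qed

section \<open>Resampling block by block\<close>

text \<open>Blocks are uniform and thus exchangeable; the default \<open>k\<close> is fixed because
  \<open>j < k\<close>.\<close>

lemma map_pmf_block_perm:
  assumes "j < k"
  shows "map_pmf (\<lambda>b. Transposition.transpose 0 j \<circ> b) (block_pmf m k) = block_pmf m k"
proof -
  have "Transposition.transpose 0 j ` {..<k} = {..<k}"
    using assms by (intro transpose_image_eq) auto
  then have "bij_betw (Transposition.transpose 0 j) {..<k} {..<k}"
    by (auto simp: bij_betw_def inj_on_def dest: transpose_eq_imp_eq)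
  moreover have "{..<k} \<noteq> {}"
    using assms by auto
  ultimately have "map_pmf (Transposition.transpose 0 j) (pmf_of_set {..<k}) = pmf_of_set {..<k}"
    by (intro map_pmf_of_set_bij_betw) auto
  then show ?thesis
    using Pi_pmf_map[of "{..<m}" "Transposition.transpose 0 j" k k "\<lambda>_. pmf_of_set {..<k}"] assms
    by (simp add: block_pmf_def)
qed

text \<open>
  The exchanged set avoids the queried variables, so it is unchanged by the exchange;
  this makes the exchange an involution.
\<close>

lemma map_pmf_exchange:
  fixes p :: "nat \<Rightarrow> bool pmf" and W :: "(nat \<Rightarrow> nat) \<Rightarrow> nat set"
  assumes \<mu>: "\<mu> = Pi_pmf {..<m} False p"
  shows "map_pmf (\<lambda>((x, y), b). ((override_on x y (W b - dt_queried T x),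
            override_on y x (W b - dt_queried T x)), b)) (noise_pmf m k \<mu>) = noise_pmf m k \<mu>"
proof (rule map_pmf_involution)
  fix w :: "((nat \<Rightarrow> bool) \<times> (nat \<Rightarrow> bool)) \<times> (nat \<Rightarrow> nat)"
  obtain x y b where w: "w = ((x, y), b)"
    by (metis prod.exhaust)
  let ?f = "\<lambda>((x, y), b). ((override_on x y (W b - dt_queried T x),
            override_on y x (W b - dt_queried T x)), b)"
  let ?x = "override_on x y (W b - dt_queried T x)" and ?y = "override_on y x (W b - dt_queried T x)"
  have "override_on (override_on u v S) (override_on v u S) S = u" for u v :: "nat \<Rightarrow> bool" and S
    by (simp add: override_on_def fun_eq_iff)
  then show "?f (?f w) = w"
    by (simp add: w)
  have out: "(\<forall>i. i \<notin> {..<m} \<longrightarrow> ?x i = False) \<and> (\<forall>i. i \<notin> {..<m} \<longrightarrow> ?y i = False) \<longleftrightarrow>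
      (\<forall>i. i \<notin> {..<m} \<longrightarrow> x i = False) \<and> (\<forall>i. i \<notin> {..<m} \<longrightarrow> y i = False)"
    by (auto simp: override_on_def)
  have pmf2: "pmf \<mu> u * pmf \<mu> v =
    (if (\<forall>i. i \<notin> {..<m} \<longrightarrow> u i = False) \<and> (\<forall>i. i \<notin> {..<m} \<longrightarrow> v i = False)
     then \<Prod>i<m. pmf (p i) (u i) * pmf (p i) (v i) else 0)" for u v
    by (auto simp: \<mu> pmf_Pi prod.distrib)
  have "(\<Prod>i<m. pmf (p i) (?x i) * pmf (p i) (?y i)) = (\<Prod>i<m. pmf (p i) (x i) * pmf (p i) (y i))"
    by (intro prod.cong) (auto simp: override_on_def)
  then have "pmf \<mu> ?x * pmf \<mu> ?y = pmf \<mu> x * pmf \<mu> y"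
    by (simp only: pmf2 out)
  then show "pmf (noise_pmf m k \<mu>) (?f w) = pmf (noise_pmf m k \<mu>) w"
    by (simp add: w noise_pmf_def pmf_pair)
qed

text \<open>Exchanging \<open>x\<close> and \<open>y\<close> on the unqueried part of the blocks
  below \<open>j\<close> turns the hybrid input into a fresh sample, from which only block
  \<open>j\<close> is resampled. Renaming block \<open>j\<close> to 0 gives the noise.\<close>

lemma noise_sens_block:
  assumes \<mu>: "\<mu> = Pi_pmf {..<m} False p" and j: "j < k"
  shows "measure_pmf.prob (noise_pmf m k \<mu>)
      {((x, y), b). g (override_on x y ({i. b i < j} - dt_queried T x)) \<noteq>
                    g (override_on x y ({i. b i < Suc j} - dt_queried T x))} = noise_sens m k \<mu> g T"
proof -
  let ?P = "noise_pmf m k \<mu>"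
  let ?ex = "\<lambda>((x, y), b). ((override_on x y ({i. b i < j} - dt_queried T x),
            override_on y x ({i. b i < j} - dt_queried T x)), b)"
  let ?N = "\<lambda>l. {((x, y), b). g x \<noteq> g (override_on x y ({i. b i = l} - dt_queried T x))}"
  have tr: "Transposition.transpose 0 j l = j \<longleftrightarrow> l = 0" for l
    by (auto simp: transpose_eq_iff)
  have step: "override_on (override_on x y ({i. b i < j} - Q)) (override_on y x ({i. b i < j} - Q))
      ({i. b i = j} - Q) = override_on x y ({i. b i < Suc j} - Q)"
    for x y :: "nat \<Rightarrow> bool" and b :: "nat \<Rightarrow> nat" and Q
    by (auto simp: override_on_def fun_eq_iff less_Suc_eq)
  have "measure_pmf.prob ?P {((x, y), b). g (override_on x y ({i. b i < j} - dt_queried T x)) \<noteq>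
      g (override_on x y ({i. b i < Suc j} - dt_queried T x))} =
      measure_pmf.prob (map_pmf ?ex ?P) (?N j)"
    by (auto simp: vimage_def step intro!: arg_cong2[where f = measure])
  also have "\<dots> = measure_pmf.prob ?P (?N j)"
    using map_pmf_exchange[OF \<mu>, of "\<lambda>b. {i. b i < j}" T k] by simp
  also have "\<dots> = measure_pmf.prob (map_pmf (\<lambda>(v, b). (v, Transposition.transpose 0 j \<circ> b)) ?P) (?N j)"
    using map_pair[of "\<lambda>v. v" "\<lambda>b. Transposition.transpose 0 j \<circ> b" "pair_pmf \<mu> \<mu>" "block_pmf m k"]
    by (simp add: noise_pmf_def map_pmf_block_perm[OF j])
  also have "\<dots> = noise_sens m k \<mu> g T"
    unfolding noise_sens_def
    by (auto simp: vimage_def tr intro!: arg_cong2[where f = measure])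
  finally show ?thesis .
qed

text \<open>A hybrid argument: a change of \<open>g\<close> between the first and last hybrid must
  occur at one of the \<open>k\<close> steps.\<close>

lemma prob_resample_le:
  assumes \<mu>: "\<mu> = Pi_pmf {..<m} False p" and k: "k > 0"
  shows "measure_pmf.prob (pair_pmf \<mu> \<mu>) {(x, y). g x \<noteq> g (override_on y x (dt_queried T x))}
      \<le> real k * noise_sens m k \<mu> g T"
proof -
  let ?P = "noise_pmf m k \<mu>"
  let ?h = "\<lambda>j x y b. override_on x y ({i. b i < j} - dt_queried T x)"
  let ?D = "\<lambda>j. {((x, y), b). g (?h j x y b) \<noteq> g (?h (Suc j) x y b)}"
  have tele: "measure_pmf.prob ?P {((x, y), b). g x \<noteq> g (?h n x y b)}
      \<le> (\<Sum>j<n. measure_pmf.prob ?P (?D j))" for n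
  proof (induction n)
    case (Suc n)
    have "measure_pmf.prob ?P {((x, y), b). g x \<noteq> g (?h (Suc n) x y b)} \<le>
        measure_pmf.prob ?P ({((x, y), b). g x \<noteq> g (?h n x y b)} \<union> ?D n)"
      by (intro measure_pmf.finite_measure_mono) auto
    also have "\<dots> \<le> measure_pmf.prob ?P {((x, y), b). g x \<noteq> g (?h n x y b)} +
        measure_pmf.prob ?P (?D n)"
      by (intro measure_Un_le) auto
    finally show ?case
      using Suc by simp
  qed simp
  \<comment> \<open>Outside the cube \<open>b i < k\<close> may fail, but there \<open>x\<close> and
    \<open>y\<close> are both \<open>False\<close>.\<close>
  have h: "override_on y x (dt_queried T x) = ?h k x y b"
    if "((x, y), b) \<in> set_pmf ?P" for x y b
  proof -
    have "\<forall>i. i \<notin> {..<m} \<longrightarrow> x i = False" "\<forall>i. i \<notin> {..<m} \<longrightarrow> y i = False"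
      using that set_Pi_pmf_subset[of "{..<m}" False p] by (auto simp: noise_pmf_def \<mu>)
    moreover have "b i < k" if "i < m" for i
    proof -
      have "{..<k} \<noteq> {}"
        using k by auto
      then show ?thesis
        using that \<open>((x, y), b) \<in> set_pmf ?P\<close>
        by (auto simp: noise_pmf_def block_pmf_def set_Pi_pmf PiE_dflt_def)
    qed
    ultimately have "x i = y i \<or> b i < k" for i
      by (cases "i < m") auto
    then show ?thesis
      unfolding override_on_def by (intro ext) auto
  qed
  have "measure_pmf.prob (pair_pmf \<mu> \<mu>) {(x, y). g x \<noteq> g (override_on y x (dt_queried T x))} =
      measure_pmf.prob ?P {((x, y), b). g x \<noteq> g (override_on y x (dt_queried T x))}"
    using prob_pair_pmf_Times[of "pair_pmf \<mu> \<mu>" "block_pmf m k"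
        "\<lambda>(x, y). g x \<noteq> g (override_on y x (dt_queried T x))" "\<lambda>_. True"]
    by (simp add: noise_pmf_def case_prod_unfold)
  also have "\<dots> = measure_pmf.prob ?P {((x, y), b). g x \<noteq> g (?h k x y b)}"
    by (intro measure_pmf.finite_measure_eq_AE) (auto simp: AE_measure_pmf_iff h)
  also have "\<dots> \<le> (\<Sum>j<k. noise_sens m k \<mu> g T)"
    using tele[of k] noise_sens_block[OF \<mu>, of _ k g T] by simp
  finally show ?thesis
    by simp
qed

section \<open>The bound on distributional complexity\<close>

lemma D_dist_le_RS:
  assumes \<mu>: "\<mu> \<in> prod_dists m" and t: "9 * RS m g + 3 \<le> 2 ^ t"
  shows "D_dist (1/3) m \<mu> g \<le> RS m g * t"
proof -
  obtain R where R: "R \<in> rand_dtrees m" "query_complexity R = RS m g" "sabotages (1/3) m g R"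
    using RS_eps_attained(1)[of "1/3" m g] by (auto simp: RS_def)
  obtain p where p: "\<mu> = Pi_pmf {..<m} False (\<lambda>i. bernoulli_pmf (p i))"
    using \<mu> by (auto simp: prod_dists_def)
  define k where "k = 3 * RS m g + 1"
  obtain T :: "unit dtree" where T: "T \<in> dtrees m" "dt_depth T \<le> RS m g * t"
    "noise_sens m k \<mu> g T \<le> 1 / 2 ^ t"
    using ex_noise_sens_le[OF R(1,3) set_pmf_prod_dists[OF \<mu>], of k t] R(2) by (auto simp: k_def)
  let ?X = "{(x, y). g x \<noteq> g (override_on y x (dt_queried T x))}"
  \<comment> \<open>The assumption on \<open>t\<close> is exactly this, as
    \<open>3 * k = 9 * RS m g + 3\<close>.\<close>
  have "3 * real k \<le> 2 ^ t"
    using of_nat_mono[OF t, where ?'a = real] by (simp add: k_def)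
  then have "real k * (1 / 2 ^ t) \<le> 1/3"
    by (simp add: field_simps)
  moreover have "real k * noise_sens m k \<mu> g T \<le> real k * (1 / 2 ^ t)"
    using T(3) by (intro mult_left_mono) auto
  ultimately have X: "measure_pmf.prob (pair_pmf \<mu> \<mu>) ?X \<le> 1/3"
    using prob_resample_le[OF p, of k g T] k_def by linarith
  obtain z where "measure_pmf.prob \<mu> {x. (x, z) \<in> ?X} \<le> measure_pmf.prob (pair_pmf \<mu> \<mu>) ?X"
    using ex_prob_le_prob_pair_pmf[of \<mu> \<mu> "{(y, x). (x, y) \<in> ?X}"]
    unfolding prob_pair_pmf_swap[of \<mu> \<mu> ?X] by auto
  then have "measure_pmf.prob \<mu> {x. dt_run (dt_relabel g T z) x \<noteq> g x} \<le> 1/3"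
    using X by (simp add: dt_relabel_run eq_commute)
  moreover have "dt_relabel g T z \<in> dtrees m"
    using T(1) by (simp add: dtrees_def dt_relabel_vars)
  ultimately have "D_dist (1/3) m \<mu> g \<le> dt_depth T"
    unfolding D_dist_def
    by (intro Least_le bexI[of _ "dt_relabel g T z"]) (simp_all add: dt_relabel_depth)
  then show ?thesis
    using T(2) by simp
qed

lemma D_prod_le_RS:
  assumes "9 * RS m g + 3 \<le> 2 ^ t"
  shows "D_prod m g \<le> RS m g * t"
  unfolding D_prod_def D_prod_eps_def
  using D_prod_eps_set[of "1/3" m g] by (intro Max.boundedI) (auto intro: D_dist_le_RS assms)

text \<open>The logarithm may be taken of \<open>D_prod\<close> instead of \<open>RS\<close>: the
  bound is trivial unless \<open>RS\<close> is the smaller one.\<close>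

lemma D_prod_le_RS_log:
  "real (D_prod m g) \<le> 6 * real (RS m g) * log 2 (2 + real (D_prod m g))"
proof -
  let ?D = "D_prod m g" and ?q = "RS m g"
  define L where "L = log 2 (2 + real ?D)"
  have L: "L \<ge> 1"
    by (simp add: L_def)
  show ?thesis
  proof (cases "?q \<ge> ?D")
    case True
    have "real ?q * 1 \<le> real ?q * (6 * L)"
      using L by (intro mult_left_mono) auto
    with True show ?thesis
      by (simp add: L_def)
  next
    case False
    \<comment> \<open>The summand 4 gives \<open>2 ^ t \<ge> 16 * (2 + ?D)\<close>, which exceeds
      \<open>9 * ?q + 3\<close>; and \<open>t \<le> L + 5 \<le> 6 * L\<close> as
      \<open>L \<ge> 1\<close>.\<close>
    define t where "t = nat \<lceil>L\<rceil> + 4"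
    have "2 + real ?D = 2 powr L"
      by (simp add: L_def)
    also have "\<dots> \<le> 2 powr real (nat \<lceil>L\<rceil>)"
      by (intro powr_mono) linarith+
    finally have "2 + real ?D \<le> 2 ^ nat \<lceil>L\<rceil>"
      by (simp add: powr_realpow)
    then have "real (9 * ?q + 3) \<le> real (2 ^ t)"
      using False by (simp add: t_def power_add)
    then have "9 * ?q + 3 \<le> 2 ^ t"
      by (simp only: of_nat_le_iff)
    then have "real ?D \<le> real (?q * t)"
      using D_prod_le_RS by (simp only: of_nat_le_iff)
    also have "\<dots> \<le> real ?q * (6 * L)"
      unfolding of_nat_mult
    proof (rule mult_left_mono)
      show "real t \<le> 6 * L"
        unfolding t_def using L by linarith
    qed simp
    finally show ?thesis
      by (simp add: L_def)
  qed
qed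

theorem theorem1:
  shows "\<exists>(c::real) > 0. \<exists>k::nat. \<forall>(m::nat) (g :: (nat \<Rightarrow> bool) \<Rightarrow> bool).
           real (RS m g) \<ge> c * real (D_prod m g) / (log 2 (2 + real (D_prod m g))) ^ k"
proof (intro exI[of _ "1/6"] exI[of _ 1] conjI allI)
  fix m g
  have "log 2 (2 + real (D_prod m g)) > 0"
    by simp
  then show "real (RS m g) \<ge> 1/6 * real (D_prod m g) / log 2 (2 + real (D_prod m g)) ^ 1"
    using D_prod_le_RS_log[of m g] by (simp add: field_simps)
qed simp

end
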